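(* Let $A\in\mathbb{R}^{m\times n}$, $b\in\mathbb{R}^m$, $\gamma>0$ and $k\in\{1,\dots,n\}$. The relaxation $$v^{\mathrm{SC}}=\min_{Y\in\mathbb{S}^{n+1}}\left\{\langle C_\gamma,Y\rangle\ :\ Y_{11}=1,\ Y\in\mathcal{K}\cap\mathbb{S}^{n+1}_+\right\}$$ is equivalent to the optimal perspective relaxation, in the sense that the two have the same optimal value: $$v^{\mathrm{SC}}=\max_{\mu\in\mathbb{R}^n_+,\ Q_\mu\succeq0}\ \min_{x\in\mathbb{R}^n,\ z\in\mathcal{Z}}\left\{x^\top Q_\mu x+2c^\top x+\sum_{i=1}^n\mu_i\frac{x_i^2}{z_i}+b^\top b\right\},$$ where $Q_\mu:=A^\top A+\gamma I-\operatorname{Diag}(\mu)$ (with $\operatorname{Diag}(\mu)$ the diagonal matrix with diagonal $\mu$) and $c:=-A^\top b$.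
   Context: $\mathbb{S}^{n+1}$ is the space of real symmetric $(n+1)\times(n+1)$ matrices, $\mathbb{S}^{n+1}_+$ its positive semidefinite cone, $\langle U,V\rangle=\mathrm{Tr}(UV^\top)$, $e$ the all-ones vector. For $Y\in\mathbb{S}^{n+1}$ write $Y=\begin{bmatrix}Y_{11}&Y_{12} \\ Y_{21}&Y_{22}\end{bmatrix}$ with $Y_{11}\in\mathbb{R}$, $Y_{22}\in\mathbb{S}^n$; for a square matrix $M$, $\operatorname{Diag}(M)$ is the diagonal matrix with the same diagonal as $M$. Define $$\mathcal{K}=\left\{Y\in\mathbb{S}^{n+1}:\begin{bmatrix}kY_{11}&Y_{12} \\ Y_{21}&\operatorname{Diag}(Y_{22})\end{bmatrix}\succeq0\right\},\qquad \mathcal{Z}=\{z\in[0,1]^n:\ e^\top z\le k\},$$ $$C_\gamma=\begin{bmatrix}b^\top \\ -A^\top\end{bmatrix}\begin{bmatrix}b&-A\end{bmatrix}+\begin{bmatrix}0&0^\top \\ 0&\gamma I_n\end{bmatrix}.$$ For nonnegative scalars, $s/0:=0$ if $s=0$ and $s/0:=+\infty$ if $s>0$; also $0\cdot(+\infty):=0$. Optimal values are understood as infima/suprema. *)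

theory Defs
  imports "HOL-Analysis.Analysis"
begin

text \<open>
  Symmetric matrices of size \<open>n + 1\<close> have index type \<^typ>\<open>'n option\<close>: the index
  \<^const>\<open>None\<close> is the first row and column, and \<open>Some i\<close> with \<open>i :: 'n\<close> are the others.
\<close>

definition sym_mats :: "(real^'n^'n) set" where
  "sym_mats = {M. transpose M = M}"

definition psd_cone :: "(real^'n^'n) set" where
  "psd_cone = {M \<in> sym_mats. \<forall>v. 0 \<le> v \<bullet> (M *v v)}"

definition mat_inner :: "real^'n^'n \<Rightarrow> real^'n^'n \<Rightarrow> real" where
  "mat_inner U V = trace (U ** transpose V)"

definition diag_vec :: "real^'n \<Rightarrow> real^'n^'n" where
  "diag_vec u = (\<chi> i j. if i = j then u $ i else 0)"

definition diag_part :: "real^'n^'n \<Rightarrow> real^'n^'n" where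
  "diag_part M = diag_vec (\<chi> i. M $ i $ i)"

text \<open>\<open>block_mat a r s M\<close> has corner \<open>a\<close>, first row \<open>r\<close>, first column \<open>s\<close>, and lower right block \<open>M\<close>.\<close>

definition block_mat ::
    "real \<Rightarrow> real^'n \<Rightarrow> real^'n \<Rightarrow> real^'n^'n \<Rightarrow> real^('n::finite option)^('n option)" where
  "block_mat a r s M = (\<chi> i j.
     case i of
       None \<Rightarrow> (case j of None \<Rightarrow> a | Some l \<Rightarrow> r $ l)
     | Some h \<Rightarrow> (case j of None \<Rightarrow> s $ h | Some l \<Rightarrow> M $ h $ l))"

definition blk11 :: "real^('n::finite option)^('n option) \<Rightarrow> real" where
  "blk11 Y = Y $ None $ None"

definition blk12 :: "real^('n::finite option)^('n option) \<Rightarrow> real^'n" where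
  "blk12 Y = (\<chi> j. Y $ None $ Some j)"

definition blk21 :: "real^('n::finite option)^('n option) \<Rightarrow> real^'n" where
  "blk21 Y = (\<chi> i. Y $ Some i $ None)"

definition blk22 :: "real^('n::finite option)^('n option) \<Rightarrow> real^'n^'n" where
  "blk22 Y = (\<chi> i j. Y $ Some i $ Some j)"

definition K_set :: "nat \<Rightarrow> (real^('n::finite option)^('n option)) set" where
  "K_set k = {Y \<in> sym_mats.
     block_mat (real k * blk11 Y) (blk12 Y) (blk21 Y) (diag_part (blk22 Y)) \<in> psd_cone}"

definition Z_set :: "nat \<Rightarrow> (real^'n) set" where
  "Z_set k = {z. (\<forall>i. 0 \<le> z $ i \<and> z $ i \<le> 1) \<and> (\<Sum>i\<in>UNIV. z $ i) \<le> real k}"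

text \<open>The row block matrix \<open>[b, -A]\<close>.\<close>

definition data_mat :: "real^'n^'m \<Rightarrow> real^'m \<Rightarrow> real^('n::finite option)^'m" where
  "data_mat A b = (\<chi> i j. case j of None \<Rightarrow> b $ i | Some l \<Rightarrow> - (A $ i $ l))"

definition C_mat ::
    "real^'n^'m \<Rightarrow> real^'m \<Rightarrow> real \<Rightarrow> real^('n::finite option)^('n option)" where
  "C_mat A b \<gamma> =
     transpose (data_mat A b) ** data_mat A b + block_mat 0 0 0 (\<gamma> *\<^sub>R mat 1)"

definition Q_mat :: "real^'n^'m \<Rightarrow> real \<Rightarrow> real^'n \<Rightarrow> real^'n^'n" where
  "Q_mat A \<gamma> \<mu> = transpose A ** A + \<gamma> *\<^sub>R mat 1 - diag_vec \<mu>"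

definition c_vec :: "real^'n^'m \<Rightarrow> real^'m \<Rightarrow> real^'n" where
  "c_vec A b = - (transpose A *v b)"

text \<open>
  Division and multiplication on \<^typ>\<open>ereal\<close> satisfy \<open>0 / 0 = 0\<close>, \<open>s / 0 = \<infinity>\<close> for
  \<open>s > 0\<close>, and \<open>0 * \<infinity> = 0\<close>, which is the convention required at \<open>z $ i = 0\<close>.
\<close>

lemma ereal_perspective_conventions:
  shows "0 / (0::ereal) = 0"
    and "s > 0 \<Longrightarrow> ereal s / 0 = \<infinity>"
    and "z \<noteq> 0 \<Longrightarrow> ereal s / ereal z = ereal (s / z)"
    and "0 * (\<infinity>::ereal) = 0"
  by (auto simp: divide_ereal_def divide_inverse)

definition perspective_obj ::
    "real^'n^'m \<Rightarrow> real^'m \<Rightarrow> real \<Rightarrow> real^'n \<Rightarrow> real^'n \<Rightarrow> real^'n \<Rightarrow> ereal" where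
  "perspective_obj A b \<gamma> \<mu> x z =
     ereal (x \<bullet> (Q_mat A \<gamma> \<mu> *v x) + 2 * (c_vec A b \<bullet> x))
     + (\<Sum>i\<in>UNIV. ereal (\<mu> $ i) * (ereal ((x $ i)\<^sup>2) / ereal (z $ i)))
     + ereal (b \<bullet> b)"

definition v_SC :: "real^'n^'m \<Rightarrow> real^'m \<Rightarrow> real \<Rightarrow> nat \<Rightarrow> ereal" where
  "v_SC A b \<gamma> k =
     (INF Y \<in> {Y. blk11 Y = 1 \<and> Y \<in> K_set k \<inter> psd_cone}. ereal (mat_inner (C_mat A b \<gamma>) Y))"

end

theory Submission
  imports Defs
begin

text \<open>
  Any feasible \<open>Y\<close> with blocks \<open>1, x, X\<close> dominates the perspective objective at \<open>x\<close> and
  \<open>z\<^sub>i = x\<^sub>i\<^sup>2 / X\<^sub>i\<^sub>i\<close>, since the trace pairing of the positive semidefinite matrices \<open>Q\<^sub>\<mu>\<close> and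
  \<open>X - x x\<^sup>T\<close> is nonnegative. Conversely, the cone constraint is the existence of \<open>z\<close> with
  \<open>x\<^sub>i\<^sup>2 / z\<^sub>i \<le> X\<^sub>i\<^sub>i\<close>, which is jointly convex for \<open>z > 0\<close> and strictly satisfied at
  \<open>Y = I\<close>, \<open>z = (k/n) e\<close>. Lagrange multipliers \<open>\<mu>\<close> of this constraint are the optimal \<open>\<mu>\<close>:
  evaluating the Lagrangian at \<open>X = x x\<^sup>T + t v v\<^sup>T\<close> and letting \<open>t\<close> grow forces
  \<open>Q\<^sub>\<mu>\<close> to be positive semidefinite, and \<open>t = 0\<close> gives the perspective objective. Weights \<open>z\<close>
  with zero entries are approximated by positive ones.
\<close>

section \<open>Trace pairing and quadratic forms as entrywise sums\<close>

lemma sum_UNIV_option: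
  fixes f :: "'n::finite option \<Rightarrow> 'a::comm_monoid_add"
  shows "(\<Sum>i\<in>UNIV. f i) = f None + (\<Sum>i\<in>UNIV. f (Some i))"
  by (simp add: UNIV_option_conv sum.reindex)

lemma mat_inner_eq_sum: "mat_inner U V = (\<Sum>i\<in>UNIV. \<Sum>j\<in>UNIV. U $ i $ j * V $ i $ j)"
  by (simp add: mat_inner_def trace_def matrix_matrix_mult_def transpose_def)

lemma inner_matrix_vector_eq_sum:
  fixes M :: "real^'n^'n"
  shows "v \<bullet> (M *v v) = (\<Sum>i\<in>UNIV. \<Sum>j\<in>UNIV. M $ i $ j * (v $ i * v $ j))"
  by (simp add: inner_vec_def matrix_vector_mult_def sum_distrib_left mult_ac)

definition outer :: "real^'n \<Rightarrow> real^'n^'n" where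
  "outer v = (\<chi> i j. v $ i * v $ j)"

lemma outer_nth [simp]: "outer v $ i $ j = v $ i * v $ j"
  by (simp add: outer_def)

lemma mat_inner_outer: "mat_inner M (outer v) = v \<bullet> (M *v v)"
  by (simp add: mat_inner_eq_sum inner_matrix_vector_eq_sum)

lemma inner_outer_mult: "v \<bullet> (outer w *v v) = (w \<bullet> v)\<^sup>2"
  unfolding inner_matrix_vector_eq_sum
  by (simp add: inner_vec_def power2_eq_square sum_product mult_ac)

lemma mat_inner_add_right: "mat_inner W (U + V) = mat_inner W U + mat_inner W V"
  by (simp add: mat_inner_eq_sum algebra_simps sum.distrib)

lemma mat_inner_diff_right: "mat_inner W (U - V) = mat_inner W U - mat_inner W V"
  by (simp add: mat_inner_eq_sum algebra_simps sum_subtractf)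

lemma mat_inner_diff_left: "mat_inner (U - V) W = mat_inner U W - mat_inner V W"
  by (simp add: mat_inner_eq_sum algebra_simps sum_subtractf)

lemma mat_inner_scaleR_left: "mat_inner (c *\<^sub>R U) V = c * mat_inner U V"
  by (simp add: mat_inner_eq_sum sum_distrib_left mult_ac)

lemma mat_inner_scaleR_right: "mat_inner U (c *\<^sub>R V) = c * mat_inner U V"
  by (simp add: mat_inner_eq_sum sum_distrib_left mult_ac)

lemma mat_inner_commute: "mat_inner U V = mat_inner V U"
  by (simp add: mat_inner_eq_sum mult.commute)

lemma mat_inner_diag_vec: "mat_inner (diag_vec u) X = (\<Sum>i\<in>UNIV. u $ i * X $ i $ i)"
  by (simp add: mat_inner_eq_sum diag_vec_def if_distrib [of "\<lambda>c. c * _"] cong: if_cong)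

section \<open>Positive semidefinite matrices and self-duality of their cone\<close>

lemma sym_mats_iff: "M \<in> sym_mats \<longleftrightarrow> (\<forall>i j. M $ i $ j = M $ j $ i)"
  by (auto simp: sym_mats_def transpose_def vec_eq_iff)

lemma psd_cone_sym: "M \<in> psd_cone \<Longrightarrow> M $ i $ j = M $ j $ i"
  using sym_mats_iff by (auto simp: psd_cone_def)

lemma psd_cone_quadratic: "M \<in> psd_cone \<Longrightarrow> 0 \<le> v \<bullet> (M *v v)"
  by (simp add: psd_cone_def)

lemma quadratic_form_axis_add:
  fixes M :: "real^'n^'n"
  assumes "M \<in> sym_mats"
  shows "(v + t *\<^sub>R axis i 1) \<bullet> (M *v (v + t *\<^sub>R axis i 1))
    = v \<bullet> (M *v v) + 2 * t * (M $ i \<bullet> v) + t\<^sup>2 * M $ i $ i"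
proof -
  have T: "transpose M = M" using assms by (simp add: sym_mats_def)
  have a: "axis i 1 \<bullet> (M *v w) = M $ i \<bullet> w" for w :: "real^'n"
    by (simp add: inner_axis' matrix_vector_mul_component)
  have b: "v \<bullet> (M *v axis i 1) = M $ i \<bullet> v"
    using a[of v] T by (metis dot_lmul_matrix inner_commute transpose_matrix_vector)
  show ?thesis
    by (simp add: matrix_vector_right_distrib matrix_vector_mult_scaleR inner_add_left
        inner_add_right a b inner_axis power2_eq_square algebra_simps)
qed

lemma psd_cone_diag_nonneg: "M \<in> psd_cone \<Longrightarrow> 0 \<le> M $ i $ i"
  by (drule psd_cone_quadratic[of M "axis i 1"])
    (simp add: inner_axis' inner_axis matrix_vector_mul_component)

text \<open>This is the Cauchy-Schwarz inequality for the semi-inner product of \<open>M\<close>,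
  applied to \<open>axis i 1\<close> and \<open>v\<close>: the quadratic polynomial in
  \<open>t\<close> from \<open>quadratic_form_axis_add\<close> has no negative value. In particular
  a zero diagonal entry forces its whole row to vanish.\<close>

lemma psd_cone_row_sq_le:
  assumes "M \<in> psd_cone"
  shows "(M $ i \<bullet> v)\<^sup>2 \<le> M $ i $ i * (v \<bullet> (M *v v))"
proof -
  have q: "0 \<le> v \<bullet> (M *v v) + 2 * t * (M $ i \<bullet> v) + t\<^sup>2 * M $ i $ i" for t
    using psd_cone_quadratic[OF assms, of "v + t *\<^sub>R axis i 1"] quadratic_form_axis_add[of M v t i] assms
    by (simp add: psd_cone_def)
  show ?thesis
  proof (cases "M $ i $ i = 0")
    case True
    have "M $ i \<bullet> v = 0"
    proof (rule ccontr)
      assume "M $ i \<bullet> v \<noteq> 0"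
      then show False
        \<comment> \<open>With zero leading coefficient the polynomial is affine in
          \<open>t\<close>; this \<open>t\<close> gives it the value -1.\<close>
        using q[of "- (v \<bullet> (M *v v) + 1) / (2 * (M $ i \<bullet> v))"] True by (simp add: field_simps)
    qed
    then show ?thesis using True by simp
  next
    case False
    then have "M $ i $ i > 0" using psd_cone_diag_nonneg[OF assms, of i] by simp
    then show ?thesis
      \<comment> \<open>The minimiser of the quadratic polynomial in \<open>t\<close>.\<close>
      using q[of "- (M $ i \<bullet> v) / (M $ i $ i)"]
      by (simp add: field_simps power2_eq_square)
  qed
qed

text \<open>Eliminating one nonzero diagonal entry of \<open>P\<close> by a Schur complement subtracts a rank-one
  positive semidefinite matrix, so no spectral decomposition is needed.\<close>

lemma mat_inner_psd_nonneg:
  fixes P S :: "real^'n^'n"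
  assumes "P \<in> psd_cone" "S \<in> psd_cone"
  shows "0 \<le> mat_inner P S"
  using assms(1)
proof (induction "card {i. P $ i $ i \<noteq> 0}" arbitrary: P rule: less_induct)
  case less
  show ?case
  proof (cases "\<forall>i. P $ i $ i = 0")
    case True
    have "P $ i $ j = 0" for i j
      using psd_cone_row_sq_le[OF less.prems, of i "axis j 1"] True
      by (simp add: inner_axis)
    then show ?thesis by (simp add: mat_inner_eq_sum)
  next
    case False
    then obtain i where i: "P $ i $ i \<noteq> 0" by blast
    then have pos: "P $ i $ i > 0"
      using psd_cone_diag_nonneg[OF less.prems, of i] by simp
    define R where "R = (1 / P $ i $ i) *\<^sub>R outer (P $ i)"
    have Rnth: "R $ a $ b = P $ i $ a * P $ i $ b / P $ i $ i" for a b
      by (simp add: R_def)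
    have psd: "P - R \<in> psd_cone"
      unfolding psd_cone_def
    proof (intro CollectI conjI allI)
      show "P - R \<in> sym_mats"
        using psd_cone_sym[OF less.prems] by (simp add: sym_mats_iff Rnth mult.commute)
    next
      fix v
      have "v \<bullet> ((P - R) *v v) = v \<bullet> (P *v v) - (P $ i \<bullet> v)\<^sup>2 / P $ i $ i"
        by (simp add: R_def matrix_vector_mult_diff_rdistrib scaleR_matrix_vector_assoc [symmetric]
            inner_diff_right inner_outer_mult)
      then show "0 \<le> v \<bullet> ((P - R) *v v)"
        using psd_cone_row_sq_le[OF less.prems, of i v] pos
        by (simp add: pos_divide_le_eq mult.commute)
    qed
    \<comment> \<open>The induction measure drops: a zero diagonal entry of \<open>P\<close> has a
      zero row, so subtracting \<open>R\<close> leaves it zero, and entry \<open>i\<close> becomes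
      zero.\<close>
    have "{j. (P - R) $ j $ j \<noteq> 0} \<subset> {j. P $ j $ j \<noteq> 0}"
    proof
      show "{j. (P - R) $ j $ j \<noteq> 0} \<subseteq> {j. P $ j $ j \<noteq> 0}"
      proof safe
        fix j assume "(P - R) $ j $ j \<noteq> 0" "P $ j $ j = 0"
        moreover have "P $ j $ i = 0"
          using psd_cone_row_sq_le[OF less.prems, of j "axis i 1"] \<open>P $ j $ j = 0\<close>
          by (simp add: inner_axis)
        ultimately show False using psd_cone_sym[OF less.prems, of j i] by (simp add: Rnth)
      qed
      show "{j. (P - R) $ j $ j \<noteq> 0} \<noteq> {j. P $ j $ j \<noteq> 0}"
      proof
        assume "{j. (P - R) $ j $ j \<noteq> 0} = {j. P $ j $ j \<noteq> 0}"
        then have "i \<in> {j. (P - R) $ j $ j \<noteq> 0}" using i by blast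
        then show False using i by (simp add: Rnth)
      qed
    qed
    then have "0 \<le> mat_inner (P - R) S"
      by (intro less.hyps psubset_card_mono psd) simp
    moreover have "0 \<le> mat_inner R S"
      using psd_cone_quadratic[OF assms(2), of "P $ i"] pos
      by (simp add: R_def mat_inner_scaleR_left mat_inner_commute[of "outer (P $ i)" S] mat_inner_outer)
    ultimately show ?thesis by (simp add: mat_inner_diff_left)
  qed
qed

section \<open>Block matrices, the cone \<open>K_set\<close> and the cost matrix\<close>

definition cons_vec :: "real \<Rightarrow> real^'n \<Rightarrow> real^('n::finite option)" where
  "cons_vec a v = (\<chi> i. case i of None \<Rightarrow> a | Some l \<Rightarrow> v $ l)"

lemma cons_vec_nth [simp]: "cons_vec a v $ None = a" "cons_vec a v $ Some i = v $ i"
  by (simp_all add: cons_vec_def)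

lemma cons_vec_cases: obtains a v where "w = cons_vec a v"
proof
  show "w = cons_vec (w $ None) (\<chi> i. w $ Some i)"
    by (auto simp: vec_eq_iff cons_vec_def split: option.split)
qed

lemma block_mat_nth [simp]:
  "block_mat a r s M $ None $ None = a" "block_mat a r s M $ None $ Some j = r $ j"
  "block_mat a r s M $ Some i $ None = s $ i" "block_mat a r s M $ Some i $ Some j = M $ i $ j"
  by (simp_all add: block_mat_def)

lemma blk_nth [simp]:
  "blk12 Y $ j = Y $ None $ Some j" "blk21 Y $ i = Y $ Some i $ None"
  "blk22 Y $ i $ j = Y $ Some i $ Some j"
  by (simp_all add: blk12_def blk21_def blk22_def)

lemma blk12_eq_blk21: "Y \<in> sym_mats \<Longrightarrow> blk21 Y = blk12 Y"
  by (simp add: vec_eq_iff sym_mats_iff)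

lemma block_mat_blk: "block_mat (blk11 Y) (blk12 Y) (blk21 Y) (blk22 Y) = Y"
  by (auto simp: vec_eq_iff block_mat_def blk11_def split: option.split)

lemma block_mat_sym_iff: "block_mat a r r M \<in> sym_mats \<longleftrightarrow> M \<in> sym_mats"
  by (simp add: sym_mats_iff split_option_all)

lemma quadratic_form_block_mat:
  "cons_vec a v \<bullet> (block_mat d r r M *v cons_vec a v) = d * a\<^sup>2 + 2 * a * (r \<bullet> v) + v \<bullet> (M *v v)"
  unfolding inner_matrix_vector_eq_sum
  by (simp add: sum_UNIV_option inner_vec_def sum.distrib sum_distrib_left power2_eq_square mult_ac)

lemma block_mat_psd_iff:
  "block_mat d r r M \<in> psd_cone \<longleftrightarrow>
    M \<in> sym_mats \<and> (\<forall>a v. 0 \<le> d * a\<^sup>2 + 2 * a * (r \<bullet> v) + v \<bullet> (M *v v))"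
  unfolding psd_cone_def
  by (auto simp: block_mat_sym_iff quadratic_form_block_mat [symmetric]) (metis cons_vec_cases)

text \<open>The Schur complement of the corner entry 1: for fixed \<open>v\<close>, the block
  quadratic form is minimised over the corner variable \<open>a\<close> at
  \<open>a = - (blk12 Y \<bullet> v)\<close>, and the minimum is the form of the complement.\<close>

lemma psd_blk:
  assumes "Y \<in> psd_cone" "blk11 Y = 1"
  shows "blk22 Y - outer (blk12 Y) \<in> psd_cone"
proof -
  have "Y = block_mat 1 (blk12 Y) (blk12 Y) (blk22 Y)"
    using block_mat_blk[of Y] assms blk12_eq_blk21[of Y] by (simp add: psd_cone_def)
  then have *: "blk22 Y \<in> sym_mats"
     "\<And>a v. 0 \<le> 1 * a\<^sup>2 + 2 * a * (blk12 Y \<bullet> v) + v \<bullet> (blk22 Y *v v)"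
    using assms(1) block_mat_psd_iff by metis+
  show ?thesis
    unfolding psd_cone_def
  proof (intro CollectI conjI allI)
    show "blk22 Y - outer (blk12 Y) \<in> sym_mats"
      using *(1) by (simp add: sym_mats_iff mult.commute)
    fix v show "0 \<le> v \<bullet> ((blk22 Y - outer (blk12 Y)) *v v)"
      using *(2)[of "- (blk12 Y \<bullet> v)" v]
      by (simp add: matrix_vector_mult_diff_rdistrib inner_diff_right inner_outer_mult power2_eq_square)
  qed
qed

lemma quadratic_form_diag_vec: "v \<bullet> (diag_vec u *v v) = (\<Sum>i\<in>UNIV. u $ i * (v $ i)\<^sup>2)"
  using mat_inner_outer[of "diag_vec u" v] by (simp add: mat_inner_diag_vec power2_eq_square)

lemma diag_vec_sym: "diag_vec u \<in> sym_mats"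
  by (simp add: sym_mats_iff diag_vec_def)

lemma K_set_iff:
  "Y \<in> K_set k \<longleftrightarrow> Y \<in> sym_mats \<and>
    (\<forall>a v. 0 \<le> real k * blk11 Y * a\<^sup>2 + 2 * a * (blk12 Y \<bullet> v) + (\<Sum>i\<in>UNIV. blk22 Y $ i $ i * (v $ i)\<^sup>2))"
  using blk12_eq_blk21[of Y]
  by (auto simp: K_set_def block_mat_psd_iff diag_part_def diag_vec_sym quadratic_form_diag_vec)

lemma C_mat_nth:
  "C_mat A b \<gamma> $ None $ None = b \<bullet> b"
  "C_mat A b \<gamma> $ None $ Some j = c_vec A b $ j"
  "C_mat A b \<gamma> $ Some j $ None = c_vec A b $ j"
  "C_mat A b \<gamma> $ Some i $ Some j = (transpose A ** A + \<gamma> *\<^sub>R mat 1) $ i $ j"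
  by (simp_all add: C_mat_def data_mat_def c_vec_def matrix_matrix_mult_def transpose_def
      matrix_vector_mult_def inner_vec_def sum_negf mult.commute)

text \<open>Adding and subtracting \<open>diag_vec \<mu>\<close> lets one identity serve every
  \<open>\<mu>\<close>; the last sum is what the perspective terms are compared with.\<close>

lemma mat_inner_C_mat:
  assumes "Y \<in> sym_mats" "blk11 Y = 1"
  shows "mat_inner (C_mat A b \<gamma>) Y = b \<bullet> b + 2 * (c_vec A b \<bullet> blk12 Y)
    + mat_inner (Q_mat A \<gamma> \<mu>) (blk22 Y) + (\<Sum>i\<in>UNIV. \<mu> $ i * blk22 Y $ i $ i)"
proof -
  have "mat_inner (C_mat A b \<gamma>) Y = b \<bullet> b + 2 * (c_vec A b \<bullet> blk12 Y)
    + mat_inner (transpose A ** A + \<gamma> *\<^sub>R mat 1) (blk22 Y)"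
    using assms
    by (simp add: mat_inner_eq_sum sum_UNIV_option C_mat_nth sum.distrib inner_vec_def
        sym_mats_iff blk11_def)
  then show ?thesis
    by (simp add: Q_mat_def mat_inner_diff_left mat_inner_diag_vec)
qed

lemma Q_mat_sym: "Q_mat A \<gamma> \<mu> \<in> sym_mats"
  by (simp add: sym_mats_iff Q_mat_def diag_vec_def matrix_matrix_mult_def transpose_def mat_def
      mult.commute)

section \<open>Values of the perspective objective, and weak duality\<close>

lemma perspective_term_eq:
  assumes "z \<noteq> 0 \<or> x = 0 \<or> m = 0"
  shows "ereal m * (ereal (x\<^sup>2) / ereal z) = ereal (m * x\<^sup>2 / z)"
  using assms by (cases "z = 0") (auto simp: zero_ereal_def [symmetric])

text \<open>No summand is infinite under this condition, and real division by zero yields 0, in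
  agreement with the conventions on \<open>ereal\<close> for the summands that vanish.\<close>

lemma perspective_obj_eq:
  assumes "\<And>i. z $ i \<noteq> 0 \<or> x $ i = 0 \<or> \<mu> $ i = 0"
  shows "perspective_obj A b \<gamma> \<mu> x z = ereal (x \<bullet> (Q_mat A \<gamma> \<mu> *v x) + 2 * (c_vec A b \<bullet> x)
    + (\<Sum>i\<in>UNIV. \<mu> $ i * (x $ i)\<^sup>2 / z $ i) + b \<bullet> b)"
proof -
  have "ereal (\<mu> $ i) * (ereal ((x $ i)\<^sup>2) / ereal (z $ i)) = ereal (\<mu> $ i * (x $ i)\<^sup>2 / z $ i)" for i
    by (rule perspective_term_eq) (rule assms)
  then show ?thesis by (simp only: perspective_obj_def sum_ereal plus_ereal.simps)
qed

text \<open>Complements \<open>perspective_obj_eq\<close> for nonnegative \<open>\<mu>\<close> and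
  \<open>z\<close>: if its condition fails at some index, that summand is infinite.\<close>

lemma perspective_obj_top:
  assumes "z $ i = 0" "x $ i \<noteq> 0" "\<mu> $ i > 0" "\<And>i. 0 \<le> \<mu> $ i" "\<And>i. 0 \<le> z $ i"
  shows "perspective_obj A b \<gamma> \<mu> x z = \<infinity>"
proof -
  have "ereal (\<mu> $ i) * (ereal ((x $ i)\<^sup>2) / ereal (z $ i)) = \<infinity>"
    using assms(1-3) by (simp add: ereal_perspective_conventions)
  then have "(\<Sum>i\<in>UNIV. ereal (\<mu> $ i) * (ereal ((x $ i)\<^sup>2) / ereal (z $ i))) = \<infinity>"
    unfolding sum_Pinfty by (meson UNIV_I finite)
  then show ?thesis by (simp add: perspective_obj_def)
qed

text \<open>With the weights \<open>x $ i\<close> squared over \<open>d i\<close>, each perspective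
  term is at most \<open>\<mu> $ i * d i\<close>, and the remaining gap is the pairing of
  \<open>Q_mat A \<gamma> \<mu>\<close> with the Schur complement of \<open>Y\<close>.\<close>

lemma perspective_le_relaxation:
  fixes A :: "real^'n^'m"
  assumes \<mu>: "\<And>i. 0 \<le> \<mu> $ i" "Q_mat A \<gamma> \<mu> \<in> psd_cone"
    and Y: "blk11 Y = 1" "Y \<in> K_set k" "Y \<in> psd_cone"
  shows "\<exists>z \<in> Z_set k. perspective_obj A b \<gamma> \<mu> (blk12 Y) z \<le> ereal (mat_inner (C_mat A b \<gamma>) Y)"
proof -
  define x where "x = blk12 Y"
  define d where "d i = blk22 Y $ i $ i" for i
  define z where "z = (\<chi> i. (x $ i)\<^sup>2 / d i)"
  have S: "blk22 Y - outer x \<in> psd_cone" using psd_blk Y unfolding x_def by blast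
  have d: "(x $ i)\<^sup>2 \<le> d i" for i
    using psd_cone_diag_nonneg[OF S, of i] by (simp add: d_def power2_eq_square)
  then have d0: "0 \<le> d i" for i by (meson order_trans zero_le_power2)
  have x0: "x $ i = 0" if "d i = 0" for i using d[of i] that by simp
  \<comment> \<open>For \<open>a = 1\<close> this \<open>v\<close> minimises the quadratic form in
    \<open>K_set_iff\<close>. The minimum is \<open>k\<close> minus the sum of \<open>z\<close>, so
    its nonnegativity is the budget constraint. Indices with \<open>d i = 0\<close> contribute 0
    because \<open>x $ i = 0\<close> there.\<close>
  define v where "v = (\<chi> i. - (x $ i) / d i)"
  have "0 \<le> real k * 1 * 1\<^sup>2 + 2 * 1 * (x \<bullet> v) + (\<Sum>i\<in>UNIV. d i * (v $ i)\<^sup>2)"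
    using conjunct2[OF Y(2)[unfolded K_set_iff], rule_format, of 1 v] Y(1)
    by (simp only: x_def d_def)
  also have "2 * 1 * (x \<bullet> v) = (\<Sum>i\<in>UNIV. - 2 * z $ i)"
    by (simp add: inner_vec_def v_def z_def sum_distrib_left power2_eq_square sum_negf)
  also have "(\<Sum>i\<in>UNIV. d i * (v $ i)\<^sup>2) = (\<Sum>i\<in>UNIV. z $ i)"
    by (rule sum.cong) (auto simp: v_def z_def power2_eq_square)
  finally have "(\<Sum>i\<in>UNIV. z $ i) \<le> real k" by (simp add: sum_distrib_left [symmetric] sum_negf)
  then have zZ: "z \<in> Z_set k"
    using d d0 by (auto simp: Z_set_def z_def divide_le_eq_1 less_le)
  have "perspective_obj A b \<gamma> \<mu> x z = ereal (x \<bullet> (Q_mat A \<gamma> \<mu> *v x) + 2 * (c_vec A b \<bullet> x)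
    + (\<Sum>i\<in>UNIV. \<mu> $ i * (x $ i)\<^sup>2 / z $ i) + b \<bullet> b)"
    by (rule perspective_obj_eq) (use x0 in \<open>auto simp: z_def\<close>)
  also have "\<dots> \<le> ereal (mat_inner (C_mat A b \<gamma>) Y)"
  proof -
    have "x \<bullet> (Q_mat A \<gamma> \<mu> *v x) \<le> mat_inner (Q_mat A \<gamma> \<mu>) (blk22 Y)"
      using mat_inner_psd_nonneg[OF \<mu>(2) S] by (simp add: mat_inner_diff_right mat_inner_outer)
    moreover have "(\<Sum>i\<in>UNIV. \<mu> $ i * (x $ i)\<^sup>2 / z $ i) \<le> (\<Sum>i\<in>UNIV. \<mu> $ i * d i)"
      by (rule sum_mono) (use \<mu>(1) d0 in \<open>auto simp: z_def\<close>)
    ultimately show ?thesis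
      using mat_inner_C_mat[of Y A b \<gamma> \<mu>] Y(1,3) by (simp add: psd_cone_def d_def x_def)
  qed
  finally show ?thesis using zZ by (auto simp: x_def)
qed

section \<open>Lagrange multipliers for convex programs with a Slater point\<close>

lemma nonneg_coeff_of_bounded_below:
  fixes r s p :: real
  assumes "\<And>t. 0 \<le> t \<Longrightarrow> p \<le> r + t * s"
  shows "0 \<le> s"
proof (rule ccontr)
  assume s: "\<not> 0 \<le> s"
  \<comment> \<open>This choice makes \<open>r + t * s\<close> at most \<open>p - 1\<close>.\<close>
  define t where "t = (\<bar>r - p\<bar> + 1) / - s"
  have "0 \<le> t" using s by (simp add: t_def divide_nonneg_neg)
  moreover have "t * s = - (\<bar>r - p\<bar> + 1)" using s by (simp add: t_def)
  ultimately show False using assms[of t] by simp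
qed

text \<open>A hyperplane separates \<open>(0, p)\<close> from the convex set of constraint bounds
  and values that points of \<open>D\<close> can meet. The Slater point makes the value component of
  its normal positive, and dividing by that component gives the multipliers.\<close>

lemma convex_lagrange_multipliers:
  fixes f :: "'a::real_vector \<Rightarrow> real" and g :: "'n::finite \<Rightarrow> 'a \<Rightarrow> real"
  assumes f: "convex_on D f" and g: "\<And>i. convex_on D (g i)"
    and slater: "y\<^sub>0 \<in> D" "\<And>i. g i y\<^sub>0 < 0"
    and lower: "\<And>y. y \<in> D \<Longrightarrow> (\<And>i. g i y \<le> 0) \<Longrightarrow> p \<le> f y"
  obtains \<mu> :: "real^'n"
  where "\<And>i. 0 \<le> \<mu> $ i" "\<And>y. y \<in> D \<Longrightarrow> p \<le> f y + (\<Sum>i\<in>UNIV. \<mu> $ i * g i y)"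
proof -
  \<comment> \<open>The strict bound on \<open>f y\<close> keeps \<open>(0, p)\<close> outside
    \<open>S\<close>, since \<open>p \<le> f y\<close> at every feasible \<open>y\<close>.\<close>
  define S :: "((real^'n) \<times> real) set" where
    "S = {(u, w). \<exists>y\<in>D. (\<forall>i. g i y \<le> u $ i) \<and> f y < w}"
  have inS: "(u, w) \<in> S" if "y \<in> D" "\<And>i. g i y \<le> u $ i" "f y < w" for u w y
    using that by (auto simp: S_def)
  have "convex S"
  proof (rule convexI)
    fix P Q and s t :: real
    assume PQ: "P \<in> S" "Q \<in> S" and st: "0 \<le> s" "0 \<le> t" "s + t = 1"
    obtain u w y where P: "P = (u, w)" "y \<in> D" "\<And>i. g i y \<le> u $ i" "f y < w"
      using PQ(1) by (auto simp: S_def)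
    obtain u' w' y' where Q: "Q = (u', w')" "y' \<in> D" "\<And>i. g i y' \<le> u' $ i" "f y' < w'"
      using PQ(2) by (auto simp: S_def)
    have "convex D" using f by (rule convex_on_imp_convex)
    then have "s *\<^sub>R y + t *\<^sub>R y' \<in> D" using P Q st by (simp add: convexD)
    moreover have "g i (s *\<^sub>R y + t *\<^sub>R y') \<le> (s *\<^sub>R u + t *\<^sub>R u') $ i" for i
    proof -
      have "g i (s *\<^sub>R y + t *\<^sub>R y') \<le> s * g i y + t * g i y'"
        using g[of i] P(2) Q(2) st by (simp add: convex_on_def)
      also have "\<dots> \<le> s * u $ i + t * u' $ i"
        using P(3)[of i] Q(3)[of i] st by (intro add_mono mult_left_mono) auto
      finally show ?thesis by simp
    qed
    moreover have "f (s *\<^sub>R y + t *\<^sub>R y') < s *\<^sub>R w + t *\<^sub>R w'"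
    proof -
      have "f (s *\<^sub>R y + t *\<^sub>R y') \<le> s * f y + t * f y'"
        using f P(2) Q(2) st by (simp add: convex_on_def)
      also have "\<dots> < s * w + t * w'"
      \<comment> \<open>Strictness comes from \<open>y'\<close> if \<open>s = 0\<close>, and from
        \<open>y\<close> otherwise.\<close>
      proof (cases "s = 0")
        case True then show ?thesis using Q st by simp
      next
        case False
        then have "s * f y < s * w" using P st by simp
        moreover have "t * f y' \<le> t * w'" using Q st by (simp add: mult_left_mono)
        ultimately show ?thesis by simp
      qed
      finally show ?thesis by simp
    qed
    ultimately show "s *\<^sub>R P + t *\<^sub>R Q \<in> S" using inS P(1) Q(1) by simp
  qed
  moreover have "S \<noteq> {}"
    using inS[OF slater(1), of 0 "f y\<^sub>0 + 1"] slater(2) by (auto simp: less_imp_le)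
  moreover have "{(0, p)} \<inter> S = {}"
  proof -
    have "\<not> f y < p" if "y \<in> D" "\<forall>i. g i y \<le> 0" for y using lower[OF that(1)] that(2) by simp
    then show ?thesis by (auto simp: S_def)
  qed
  ultimately have "\<exists>a c. a \<noteq> 0 \<and> (\<forall>q\<in>{(0, p)}. a \<bullet> q \<le> c) \<and> (\<forall>q\<in>S. c \<le> a \<bullet> q)"
    by (intro separating_hyperplane_sets) auto
  then obtain a c where a: "a \<noteq> 0" "a \<bullet> (0, p) \<le> c" "\<And>q. q \<in> S \<Longrightarrow> c \<le> a \<bullet> q"
    by blast
  obtain l r where lr: "a = (l, r)" by (cases a)
  have sep: "r * p \<le> l \<bullet> u + r * w" if "(u, w) \<in> S" for u w
    using a(2) a(3)[OF that] by (simp add: lr)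
  \<comment> \<open>\<open>S\<close> is closed under increasing any coordinate, so the separating
    functional is bounded below along each coordinate ray; hence \<open>l\<close> and
    \<open>r\<close> are nonnegative.\<close>
  have l0: "0 \<le> l $ i" for i
  proof (rule nonneg_coeff_of_bounded_below)
    fix t :: real assume "0 \<le> t"
    have "(t *\<^sub>R axis i 1, f y\<^sub>0 + 1) \<in> S"
    proof (rule inS[OF slater(1)])
      show "g j y\<^sub>0 \<le> (t *\<^sub>R axis i 1) $ j" for j
        using slater(2)[of j] \<open>0 \<le> t\<close> by (auto simp: axis_def)
    qed simp
    from sep[OF this] show "r * p \<le> r * (f y\<^sub>0 + 1) + t * l $ i"
      by (simp add: inner_axis)
  qed
  have r0: "0 \<le> r"
  proof (rule nonneg_coeff_of_bounded_below)
    fix t :: real assume "0 \<le> t"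
    have "(0, f y\<^sub>0 + 1 + t) \<in> S"
      using \<open>0 \<le> t\<close> slater(2) by (intro inS[OF slater(1)]) (simp_all add: less_imp_le)
    from sep[OF this] show "r * p \<le> r * (f y\<^sub>0 + 1) + t * r"
      by (simp add: algebra_simps)
  qed
  \<comment> \<open>If \<open>r = 0\<close>, separation at the Slater point bounds a sum of
    nonpositive terms below by 0. All terms vanish, hence so does \<open>l\<close>, contradicting
    \<open>a \<noteq> 0\<close>.\<close>
  have "r \<noteq> 0"
  proof
    assume [simp]: "r = 0"
    have "0 \<le> (\<Sum>i\<in>UNIV. l $ i * g i y\<^sub>0)"
      using sep[OF inS[OF slater(1), of "\<chi> i. g i y\<^sub>0" "f y\<^sub>0 + 1"]] by (simp add: inner_vec_def)
    moreover have "l $ i * g i y\<^sub>0 \<le> 0" for i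
      using l0[of i] slater(2)[of i] by (simp add: mult_nonneg_nonpos)
    moreover from this have "(\<Sum>i\<in>UNIV. l $ i * g i y\<^sub>0) \<le> 0" by (simp add: sum_nonpos)
    ultimately have "(\<Sum>i\<in>UNIV. - (l $ i * g i y\<^sub>0)) = 0" by (simp add: sum_negf)
    then have "l $ i * g i y\<^sub>0 = 0" for i
      using \<open>\<And>i. l $ i * g i y\<^sub>0 \<le> 0\<close> by (subst (asm) sum_nonneg_eq_0_iff) auto
    then have "l $ i = 0" for i using slater(2)[of i] by (metis (no_types) less_irrefl mult_eq_0_iff)
    then show False using a(1) by (simp add: lr vec_eq_iff zero_prod_def)
  qed
  with r0 have r: "0 < r" by simp
  show ?thesis
  proof
    show "0 \<le> ((1 / r) *\<^sub>R l) $ i" for i using l0[of i] r by simp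
    fix y assume y: "y \<in> D"
    have "p \<le> (\<Sum>i\<in>UNIV. l $ i * g i y) / r + w" if "f y < w" for w
      using sep[OF inS[OF y, of "\<chi> i. g i y" w]] that r by (simp add: inner_vec_def field_simps)
    then have "p - (\<Sum>i\<in>UNIV. l $ i * g i y) / r \<le> w" if "f y < w" for w
      using that by (simp add: diff_le_eq add.commute)
    \<comment> \<open>Points of \<open>S\<close> lie strictly above \<open>f y\<close>, so the bound
      at \<open>f y\<close> itself is reached by letting \<open>w\<close> decrease to it.\<close>
    then have "p - (\<Sum>i\<in>UNIV. l $ i * g i y) / r \<le> f y" by (rule dense_ge)
    then show "p \<le> f y + (\<Sum>i\<in>UNIV. ((1 / r) *\<^sub>R l) $ i * g i y)"
      by (simp add: sum_divide_distrib)
  qed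
qed

section \<open>Convexity of the constraints, and their relation to \<open>K_set\<close>\<close>

lemma square_over_linear_convex:
  fixes x y z w s t :: real
  assumes "0 < z" "0 < w" "0 \<le> s" "0 \<le> t" "s + t = 1"
  shows "(s * x + t * y)\<^sup>2 / (s * z + t * w) \<le> s * (x\<^sup>2 / z) + t * (y\<^sup>2 / w)"
proof -
  have pos: "0 < s * z + t * w"
    using assms by (cases "s = 0") (auto intro: add_pos_nonneg)
  \<comment> \<open>The defect in the Cauchy-Schwarz inequality with weights \<open>s * z\<close>
    and \<open>t * w\<close>.\<close>
  have "(s * (x\<^sup>2 / z) + t * (y\<^sup>2 / w)) * (s * z + t * w) - (s * x + t * y)\<^sup>2
    = s * t * (x * w - y * z)\<^sup>2 / (z * w)"
    using assms(1,2) by (simp add: field_simps power2_eq_square)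
  also have "\<dots> \<ge> 0" using assms by simp
  finally show ?thesis using pos by (simp add: pos_divide_le_eq)
qed

lemma convex_psd_cone: "convex psd_cone"
  by (rule convexI)
    (auto simp: psd_cone_def sym_mats_iff matrix_vector_mult_add_rdistrib
      scaleR_matrix_vector_assoc [symmetric] inner_add_right)

lemma convex_Z_set: "convex (Z_set k)"
proof (rule convexI)
  fix z w :: "real^'n" and s t :: real
  assume zw: "z \<in> Z_set k" "w \<in> Z_set k" and st: "0 \<le> s" "0 \<le> t" "s + t = 1"
  have "s * z $ i + t * w $ i \<le> 1" for i
    using zw st convex_bound_le[of "z $ i" 1 "w $ i" s t] by (simp add: Z_set_def)
  moreover have "(\<Sum>i\<in>UNIV. s * z $ i + t * w $ i) \<le> real k"
    using zw st convex_bound_le[of "\<Sum>i\<in>UNIV. z $ i" "real k" "\<Sum>i\<in>UNIV. w $ i" s t]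
    by (simp add: Z_set_def sum.distrib sum_distrib_left)
  ultimately show "s *\<^sub>R z + t *\<^sub>R w \<in> Z_set k"
    using zw st by (simp add: Z_set_def)
qed

text \<open>Completing the square with weights \<open>z $ i\<close> gives a nonnegative form; it
  only grows when each square over \<open>z $ i\<close> is replaced by the diagonal entry, and the
  sum of \<open>z\<close> by \<open>k\<close>.\<close>

lemma K_set_of_perspective:
  fixes Y :: "real^('n::finite option)^('n option)"
  assumes "Y \<in> psd_cone" "blk11 Y = 1" "z \<in> Z_set k" "\<And>i. 0 < z $ i"
    and le: "\<And>i. (blk12 Y $ i)\<^sup>2 / z $ i \<le> blk22 Y $ i $ i"
  shows "Y \<in> K_set k"
  unfolding K_set_iff
proof (intro conjI allI)
  show "Y \<in> sym_mats" using assms by (simp add: psd_cone_def)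
  fix a :: real and v :: "real^'n"
  define x where "x = blk12 Y"
  have "0 \<le> (\<Sum>i\<in>UNIV. z $ i * (a + x $ i * v $ i / z $ i)\<^sup>2)"
    using assms(4) by (intro sum_nonneg) (simp add: less_imp_le)
  also have "\<dots> = (\<Sum>i\<in>UNIV. z $ i * a\<^sup>2 + 2 * a * (x $ i * v $ i) + (x $ i)\<^sup>2 / z $ i * (v $ i)\<^sup>2)"
  proof (rule sum.cong)
    fix i show "z $ i * (a + x $ i * v $ i / z $ i)\<^sup>2
      = z $ i * a\<^sup>2 + 2 * a * (x $ i * v $ i) + (x $ i)\<^sup>2 / z $ i * (v $ i)\<^sup>2"
      using assms(4)[of i] by (simp add: field_simps power2_eq_square)
  qed simp
  also have "\<dots> \<le> (\<Sum>i\<in>UNIV. z $ i * a\<^sup>2 + 2 * a * (x $ i * v $ i) + blk22 Y $ i $ i * (v $ i)\<^sup>2)"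
    using le unfolding x_def by (intro sum_mono add_left_mono mult_right_mono) auto
  also have "\<dots> = (\<Sum>i\<in>UNIV. z $ i) * a\<^sup>2 + 2 * a * (x \<bullet> v) + (\<Sum>i\<in>UNIV. blk22 Y $ i $ i * (v $ i)\<^sup>2)"
    by (simp add: sum.distrib inner_vec_def sum_distrib_left sum_distrib_right)
  also have "\<dots> \<le> real k * blk11 Y * a\<^sup>2 + 2 * a * (x \<bullet> v) + (\<Sum>i\<in>UNIV. blk22 Y $ i $ i * (v $ i)\<^sup>2)"
    using assms(2,3) by (simp add: Z_set_def mult_right_mono)
  finally show "0 \<le> real k * blk11 Y * a\<^sup>2 + 2 * a * (blk12 Y \<bullet> v)
    + (\<Sum>i\<in>UNIV. blk22 Y $ i $ i * (v $ i)\<^sup>2)" by (simp add: x_def)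
qed

section \<open>Lagrangian duality for the relaxation\<close>

lemma const_mem_Z_set:
  assumes "k \<in> {1..CARD('n)}"
  shows "(\<chi> i. real k / CARD('n)) \<in> (Z_set k :: (real^'n) set)"
  using assms by (simp add: Z_set_def)

text \<open>Membership in \<open>K_set\<close> is left out because it is the constraint to be
  dualised. Positive weights keep the quotients by \<open>z $ i\<close> convex.\<close>

definition lagrange_domain :: "nat \<Rightarrow> ((real^('n::finite option)^('n option)) \<times> (real^'n)) set" where
  "lagrange_domain k = {Y \<in> psd_cone. blk11 Y = 1} \<times> {z \<in> Z_set k. \<forall>i. 0 < z $ i}"

lemma convex_lagrange_domain: "convex (lagrange_domain k)"
  unfolding lagrange_domain_def
proof (rule convex_Times)
  show "convex {Y \<in> psd_cone. blk11 (Y :: real^('a option)^('a option)) = 1}"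
    using convexD[OF convex_psd_cone] by (auto intro!: convexI simp: blk11_def)
  show "convex {z \<in> Z_set k. \<forall>i. 0 < (z :: real^'a) $ i}"
  proof (rule convexI, safe)
    fix z w :: "real^'a" and s t :: real and i
    assume zw: "z \<in> Z_set k" "w \<in> Z_set k" "\<forall>i. 0 < z $ i" "\<forall>i. 0 < w $ i"
      and st: "0 \<le> s" "0 \<le> t" "s + t = 1"
    show "s *\<^sub>R z + t *\<^sub>R w \<in> Z_set k" using zw st convexD[OF convex_Z_set] by blast
    show "0 < (s *\<^sub>R z + t *\<^sub>R w) $ i"
      using zw st by (cases "s = 0") (auto intro: add_pos_nonneg simp: less_imp_le)
  qed
qed

text \<open>Applies \<open>convex_lagrange_multipliers\<close> to the pairs \<open>(Y, z)\<close>.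
  By \<open>K_set_of_perspective\<close>, pairs satisfying the constraints have \<open>Y\<close>
  feasible for the relaxation, so \<open>p\<close> bounds their cost from below.\<close>

lemma relaxation_multipliers:
  fixes A :: "real^'n^'m"
  assumes k: "k \<in> {1..CARD('n)}" and p: "ereal p \<le> v_SC A b \<gamma> k"
  obtains \<mu> where "\<And>i. 0 \<le> \<mu> $ i"
    "\<And>Y z. (Y, z) \<in> lagrange_domain k \<Longrightarrow> p \<le> mat_inner (C_mat A b \<gamma>) Y
      + (\<Sum>i\<in>UNIV. \<mu> $ i * ((blk12 Y $ i)\<^sup>2 / z $ i - blk22 Y $ i $ i))"
proof -
  define f :: "(real^('n option)^('n option)) \<times> (real^'n) \<Rightarrow> real"
    where "f = (\<lambda>y. mat_inner (C_mat A b \<gamma>) (fst y))"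
  define g :: "'n \<Rightarrow> (real^('n option)^('n option)) \<times> (real^'n) \<Rightarrow> real"
    where "g i = (\<lambda>y. (blk12 (fst y) $ i)\<^sup>2 / snd y $ i - blk22 (fst y) $ i $ i)" for i
  have f: "convex_on (lagrange_domain k) f"
    unfolding convex_on_def
    by (simp add: convex_lagrange_domain f_def mat_inner_add_right mat_inner_scaleR_right)
  have g: "convex_on (lagrange_domain k) (g i)" for i
    unfolding convex_on_def
  proof (intro conjI convex_lagrange_domain ballI allI impI)
    fix y y' :: "(real^('n option)^('n option)) \<times> (real^'n)" and s t :: real
    assume "y \<in> lagrange_domain k" "y' \<in> lagrange_domain k" and st: "0 \<le> s" "0 \<le> t" "s + t = 1"
    then have "0 < snd y $ i" "0 < snd y' $ i" by (auto simp: lagrange_domain_def)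
    from square_over_linear_convex[OF this st, of "blk12 (fst y) $ i" "blk12 (fst y') $ i"]
    show "g i (s *\<^sub>R y + t *\<^sub>R y') \<le> s * g i y + t * g i y'"
      by (simp add: g_def algebra_simps)
  qed
  \<comment> \<open>At the identity the first row is zero off the corner and the diagonal is 1, so
    every constraint has value -1. The weights are positive as \<open>k\<close> is at least 1, and
    at most 1 as \<open>k\<close> is at most \<open>CARD('n)\<close>.\<close>
  define y0 :: "(real^('n option)^('n option)) \<times> (real^'n)" where "y0 = (mat 1, \<chi> i. real k / CARD('n))"
  have blk11_mat_1: "blk11 (mat 1 :: real^('n option)^('n option)) = 1"
    by (simp add: blk11_def mat_def)
  have y0: "y0 \<in> lagrange_domain k"
    using const_mem_Z_set[OF k] k
    by (auto simp: y0_def lagrange_domain_def psd_cone_def sym_mats_def transpose_mat blk11_mat_1)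
  have slater: "g i y0 < 0" for i by (simp add: g_def y0_def mat_def)
  have lower: "p \<le> f y" if "y \<in> lagrange_domain k" "\<And>i. g i y \<le> 0" for y
  proof -
    have "fst y \<in> K_set k"
      using that by (intro K_set_of_perspective[where z = "snd y"]) (auto simp: lagrange_domain_def g_def)
    then have "v_SC A b \<gamma> k \<le> ereal (f y)"
      unfolding v_SC_def f_def using that(1) by (intro INF_lower) (auto simp: lagrange_domain_def)
    then show ?thesis using p by (metis ereal_less_eq(3) order_trans)
  qed
  obtain \<mu> where "\<And>i. 0 \<le> \<mu> $ i" "\<And>y. y \<in> lagrange_domain k \<Longrightarrow> p \<le> f y + (\<Sum>i\<in>UNIV. \<mu> $ i * g i y)"
    using convex_lagrange_multipliers[of "lagrange_domain k" f g y0 p, OF f g y0 slater lower] by blast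
  then show ?thesis using that[of \<mu>] by (force simp: f_def g_def)
qed

lemma perspective_multipliers:
  fixes A :: "real^'n^'m"
  assumes k: "k \<in> {1..CARD('n)}" and p: "ereal p \<le> v_SC A b \<gamma> k"
  obtains \<mu> where "\<And>i. 0 \<le> \<mu> $ i" "Q_mat A \<gamma> \<mu> \<in> psd_cone"
    "\<And>x z. z \<in> Z_set k \<Longrightarrow> ereal p \<le> perspective_obj A b \<gamma> \<mu> x z"
proof -
  obtain \<mu> where \<mu>: "\<And>i. 0 \<le> \<mu> $ i" and
    L: "\<And>Y z. (Y, z) \<in> lagrange_domain k \<Longrightarrow> p \<le> mat_inner (C_mat A b \<gamma>) Y
      + (\<Sum>i\<in>UNIV. \<mu> $ i * ((blk12 Y $ i)\<^sup>2 / z $ i - blk22 Y $ i $ i))"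
    by (rule relaxation_multipliers[OF k p]) blast
  define Q where "Q = Q_mat A \<gamma> \<mu>"
  \<comment> \<open>In the Lagrangian at the rank-one perturbation \<open>X\<close>, the terms
    \<open>\<mu> $ i * X $ i $ i\<close> cancel against those in \<open>mat_inner_C_mat\<close>,
    leaving only the pairing of \<open>Q\<close> with \<open>X\<close>.\<close>
  have bound: "p \<le> b \<bullet> b + 2 * (c_vec A b \<bullet> x) + x \<bullet> (Q *v x) + t * (v \<bullet> (Q *v v))
      + (\<Sum>i\<in>UNIV. \<mu> $ i * (x $ i)\<^sup>2 / z $ i)"
    if z: "z \<in> Z_set k" "\<And>i. 0 < z $ i" and t: "0 \<le> t" for x v z t
  proof -
    define X where "X = outer x + t *\<^sub>R outer v"
    define Y where "Y = block_mat 1 x x X"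
    have Yb: "blk11 Y = 1" "blk12 Y = x" "blk22 Y = X"
      by (simp_all add: Y_def vec_eq_iff blk11_def)
    have "0 \<le> 1 * a\<^sup>2 + 2 * a * (x \<bullet> w) + w \<bullet> (X *v w)" for a w
    proof -
      have "1 * a\<^sup>2 + 2 * a * (x \<bullet> w) + w \<bullet> (X *v w) = (a + x \<bullet> w)\<^sup>2 + t * (v \<bullet> w)\<^sup>2"
        by (simp add: X_def matrix_vector_mult_add_rdistrib scaleR_matrix_vector_assoc [symmetric]
            inner_add_right inner_outer_mult power2_sum)
      then show ?thesis using t by simp
    qed
    then have "Y \<in> psd_cone"
      by (simp add: Y_def block_mat_psd_iff sym_mats_iff X_def mult.commute)
    then have "(Y, z) \<in> lagrange_domain k" "Y \<in> sym_mats"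
      using z Yb by (auto simp: lagrange_domain_def psd_cone_def)
    from L[OF this(1)] mat_inner_C_mat[OF this(2) Yb(1), of A b \<gamma> \<mu>] show ?thesis
      unfolding Yb
      by (simp add: X_def Q_def mat_inner_add_right mat_inner_scaleR_right mat_inner_outer
          right_diff_distrib sum_subtractf)
  qed
  \<comment> \<open>Here \<open>e\<close> is the all-ones vector scaled by
    \<open>k / CARD('n)\<close>, a positive point of \<open>Z_set k\<close>.\<close>
  define e :: "real^'n" where "e = (\<chi> i. real k / CARD('n))"
  have e: "e \<in> Z_set k" "\<And>i. 0 < e $ i" using const_mem_Z_set[OF k] k by (simp_all add: e_def)
  \<comment> \<open>At \<open>x = 0\<close> the bound is affine in \<open>t\<close> with slope the
    quadratic form of \<open>Q\<close>.\<close>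
  have "0 \<le> v \<bullet> (Q *v v)" for v
  proof (rule nonneg_coeff_of_bounded_below)
    show "p \<le> b \<bullet> b + t * (v \<bullet> (Q *v v))" if "0 \<le> t" for t
      using bound[OF e that, of 0 v] by simp
  qed
  then have Q: "Q \<in> psd_cone" by (simp add: psd_cone_def Q_def Q_mat_sym)
  have "ereal p \<le> perspective_obj A b \<gamma> \<mu> x z" if z: "z \<in> Z_set k" for x z
  proof (cases "\<forall>i. z $ i \<noteq> 0 \<or> x $ i = 0 \<or> \<mu> $ i = 0")
    case False
    then obtain i where "z $ i = 0" "x $ i \<noteq> 0" "\<mu> $ i > 0" using \<mu> by (metis less_le)
    moreover have "0 \<le> z $ i" for i using z by (simp add: Z_set_def)
    ultimately have "perspective_obj A b \<gamma> \<mu> x z = \<infinity>"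
      using \<mu> by (intro perspective_obj_top) auto
    then show ?thesis by simp
  next
    case nz: True
    define B where "B = b \<bullet> b + 2 * (c_vec A b \<bullet> x) + x \<bullet> (Q *v x)"
    define R where "R = (\<Sum>i\<in>UNIV. \<mu> $ i * (x $ i)\<^sup>2 / z $ i)"
    have "s * (p - B) \<le> R" if s: "0 < s" "s < 1" for s
    proof -
      \<comment> \<open>Mixing with \<open>e\<close> makes all weights positive at the cost of a factor \<open>1 / s\<close>.\<close>
      define w where "w = s *\<^sub>R z + (1 - s) *\<^sub>R e"
      have z0: "0 \<le> z $ i" for i using z by (simp add: Z_set_def)
      have w: "w \<in> Z_set k"
        unfolding w_def using convexD[OF convex_Z_set z e(1)] s by simp
      have w0: "0 < w $ i" "s * z $ i \<le> w $ i" for i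
        using s e(2)[of i] z0[of i] by (auto simp: w_def intro: add_nonneg_pos)
      have "p - B \<le> (\<Sum>i\<in>UNIV. \<mu> $ i * (x $ i)\<^sup>2 / w $ i)"
        using bound[OF w w0(1), of 0 x] by (simp add: B_def)
      also have "\<dots> \<le> (\<Sum>i\<in>UNIV. (\<mu> $ i * (x $ i)\<^sup>2 / z $ i) / s)"
      proof (rule sum_mono)
        fix i
        show "\<mu> $ i * (x $ i)\<^sup>2 / w $ i \<le> (\<mu> $ i * (x $ i)\<^sup>2 / z $ i) / s"
        proof (cases "z $ i = 0")
          case True
          then have "\<mu> $ i * (x $ i)\<^sup>2 = 0" using nz by auto
          then show ?thesis by (simp only: div_0)
        next
          case False
          then have "0 < s * z $ i" using z0[of i] s by simp
          then have "\<mu> $ i * (x $ i)\<^sup>2 / w $ i \<le> \<mu> $ i * (x $ i)\<^sup>2 / (s * z $ i)"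
            using w0(2) \<mu> by (intro divide_left_mono) (auto simp: w0(1))
          then show ?thesis by (simp add: mult.commute)
        qed
      qed
      also have "\<dots> = R / s" by (simp add: R_def sum_divide_distrib)
      finally show ?thesis using s by (simp add: field_simps)
    qed
    \<comment> \<open>The limit of \<open>s\<close> tending to 1, which removes the cost of mixing
      with \<open>e\<close>.\<close>
    then have "p - B \<le> R" by (rule field_le_mult_one_interval)
    then show ?thesis
      using nz perspective_obj_eq[of z x \<mu> A b \<gamma>] by (simp add: B_def R_def Q_def)
  qed
  then show ?thesis using that \<mu> Q unfolding Q_def by blast
qed

section \<open>Equality of the two optimal values\<close>

theorem theorem3:
  fixes A :: "real^'n^'m" and b :: "real^'m" and \<gamma> :: real and k :: nat
  assumes "\<gamma> > 0" and "k \<in> {1..CARD('n)}"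
  shows "v_SC A b \<gamma> k =
    (SUP \<mu> \<in> {\<mu>. (\<forall>i. 0 \<le> \<mu> $ i) \<and> Q_mat A \<gamma> \<mu> \<in> psd_cone}.
       INF (x, z) \<in> UNIV \<times> Z_set k. perspective_obj A b \<gamma> \<mu> x z)"
proof (rule antisym)
  show "v_SC A b \<gamma> k \<le> (SUP \<mu> \<in> {\<mu>. (\<forall>i. 0 \<le> \<mu> $ i) \<and> Q_mat A \<gamma> \<mu> \<in> psd_cone}.
       INF (x, z) \<in> UNIV \<times> Z_set k. perspective_obj A b \<gamma> \<mu> x z)" (is "_ \<le> ?R")
  \<comment> \<open>Working with \<open>q\<close> strictly below \<open>v_SC A b \<gamma> k\<close>
    leaves a real \<open>q\<close> as the only substantial case, so infinite optimal values need no
    separate treatment.\<close>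
  proof (rule dense_le)
    fix q assume q: "q < v_SC A b \<gamma> k"
    show "q \<le> ?R"
    proof (cases q)
      case (real p)
      then have "ereal p \<le> v_SC A b \<gamma> k" using q by simp
      then obtain \<mu> where \<mu>: "\<And>i. 0 \<le> \<mu> $ i" "Q_mat A \<gamma> \<mu> \<in> psd_cone"
        and le: "\<And>x z. z \<in> Z_set k \<Longrightarrow> q \<le> perspective_obj A b \<gamma> \<mu> x z"
        unfolding real by (rule perspective_multipliers[OF assms(2)]) blast
      have "q \<le> (INF (x, z) \<in> UNIV \<times> Z_set k. perspective_obj A b \<gamma> \<mu> x z)"
        using le by (auto intro!: INF_greatest)
      also have "\<dots> \<le> ?R" using \<mu> by (intro SUP_upper) auto
      finally show ?thesis .
    qed (use q in auto)
  qed
next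
  show "(SUP \<mu> \<in> {\<mu>. (\<forall>i. 0 \<le> \<mu> $ i) \<and> Q_mat A \<gamma> \<mu> \<in> psd_cone}.
       INF (x, z) \<in> UNIV \<times> Z_set k. perspective_obj A b \<gamma> \<mu> x z) \<le> v_SC A b \<gamma> k"
    unfolding v_SC_def
  proof (intro SUP_least INF_greatest)
    fix \<mu> and Y :: "real^('n option)^('n option)"
    assume "\<mu> \<in> {\<mu>. (\<forall>i. 0 \<le> \<mu> $ i) \<and> Q_mat A \<gamma> \<mu> \<in> psd_cone}"
      and "Y \<in> {Y. blk11 Y = 1 \<and> Y \<in> K_set k \<inter> psd_cone}"
    then obtain z where z: "z \<in> Z_set k"
      "perspective_obj A b \<gamma> \<mu> (blk12 Y) z \<le> ereal (mat_inner (C_mat A b \<gamma>) Y)"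
      using perspective_le_relaxation[of \<mu> A \<gamma> Y k b] by auto
    then show "(INF (x, z) \<in> UNIV \<times> Z_set k. perspective_obj A b \<gamma> \<mu> x z)
      \<le> ereal (mat_inner (C_mat A b \<gamma>) Y)"
      by (intro INF_lower2[of "(blk12 Y, z)"]) auto
  qed
qed

end
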